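(* There is a universal constant $c_0>0$ such that, for any $L_f,D>0$, $\kappa_A\ge1$, any first-order linear span algorithm (class $\mathcal A$) and any $0<\epsilon\le c_0L_fD^2$, there exists a (linear equality constrained) problem instance in $\mathcal F_{\mathrm C}(L_f,\kappa_A,D)$ such that at least $$\Omega\left(\frac{\kappa_A\sqrt{L_f}D}{\sqrt\epsilon}\right)$$ iterations are required in order to find an iterate $x_k$ satisfying $\mathrm{SubOpt}_{\mathsf C}(x_k)\le\epsilon$ with $\rho\ge\|\lambda^\star\|$.
   Context: $\Omega(\cdot)$ hides a universal positive constant. The constant $c_0$ is the universal constant in the paper's lower bound: for integers $k\ge\kappa_A$ there is an instance in the class on which every first-order linear span algorithm has $f(x_k)-f(x^\star)-\langle\lambda^\star,Ax_k-b\rangle\ge c_0\kappa_A^2L_fD^2/k^2$. For a problem $\min f(x)$ s.t. $Ax=b$, $x^\star$ is an optimal solution, $\lambda^\star$ an optimal dual variable with $A^{\mathrm T}\lambda^\star=\nabla f(x^\star)$, and $\mathrm{SubOpt}_{\mathsf C}(x)=f(x)-\min_{Ax'=b}f(x')+\rho\|Ax-b\|$. Class $\mathcal F_{\mathrm C}(L_f,\kappa_A,D)$: problems $\min_xf(x)+h(Ax-b)$ of arbitrary dimension ($h$ proper closed convex; constraints $Ax=b$ correspond to $h=\mathbb I_{\{0\}}$, the indicator function of $\{0\}$) with $f$ convex and $L_f$-smooth, $\|x_0-x^\star\|\le D$, and condition number of $A$ (norm over minimal singular value) at most $\kappa_A$. First-order linear span algorithm (class $\mathcal A$) for $\min f(x)$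 s.t. $Ax=b$, with $x_0=0$ (and zero initial dual variable): $x_k\in\mathcal S^x_k$ for all $k$, where $\mathcal S^x_0=\mathrm{Span}\{x_0\}$ and $\mathcal S^x_{k+1}=\mathrm{Span}\{x_i,\nabla f(\hat x_i),A^{\mathrm T}(A\hat x_i-b):\hat x_i\in\mathcal S^x_i,0\le i\le k\}$. *)

theory Defs
  imports
    "HOL-Library.Extended_Real"
    "Jordan_Normal_Form.VS_Connect"
    "Jordan_Normal_Form.Char_Poly"
begin

text \<open>
  The ambient dimension is quantified inside the statement, so vectors and matrices are the
  carrier-based ones of Jordan\_Normal\_Form: \<open>carrier_vec n\<close> plays the role of n-dimensional
  Euclidean space, and the analytic notions (Euclidean norm, gradient, smoothness, convexity,
  closedness) are relativised to it. Values of functions outside the carrier are irrelevant.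
\<close>

definition vnorm :: "real vec \<Rightarrow> real" where
  "vnorm x = sqrt (x \<bullet> x)"

abbreviation vspan :: "nat \<Rightarrow> real vec set \<Rightarrow> real vec set" where
  "vspan n \<equiv> LinearCombinations.module.span class_ring (module_vec TYPE(real) n)"

definition op_norm :: "real mat \<Rightarrow> real" where
  "op_norm A = Sup {vnorm (A *\<^sub>v x) | x. x \<in> carrier_vec (dim_col A) \<and> vnorm x \<le> 1}"

text \<open>
  The \<open>min m n\<close> singular values of an \<open>m \<times> n\<close> matrix: square roots of the eigenvalues of the
  smaller of the two Gram matrices. Zero is included exactly when the matrix is rank deficient.
\<close>

definition singular_values :: "real mat \<Rightarrow> real set" where
  "singular_values A =
     sqrt ` {e. eigenvalue (if dim_row A \<le> dim_col A then A * A\<^sup>T else A\<^sup>T * A) e}"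

definition min_singular_value :: "real mat \<Rightarrow> real" where
  "min_singular_value A = Min (singular_values A)"

text \<open>
  Positivity of the minimal singular value is explicit, since division by zero yields zero; a
  rank deficient matrix has infinite condition number.
\<close>

definition cond_number_le :: "real mat \<Rightarrow> real \<Rightarrow> bool" where
  "cond_number_le A \<kappa> \<longleftrightarrow>
     0 < min_singular_value A \<and> op_norm A / min_singular_value A \<le> \<kappa>"

definition has_gradient :: "nat \<Rightarrow> (real vec \<Rightarrow> real) \<Rightarrow> real vec \<Rightarrow> real vec \<Rightarrow> bool" where
  "has_gradient n f x g \<longleftrightarrow> g \<in> carrier_vec n \<and>
     (\<forall>e>0. \<exists>d>0. \<forall>y\<in>carrier_vec n. vnorm (y - x) < d \<longrightarrow>
        \<bar>f y - f x - g \<bullet> (y - x)\<bar> \<le> e * vnorm (y - x))"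

definition grad :: "nat \<Rightarrow> (real vec \<Rightarrow> real) \<Rightarrow> real vec \<Rightarrow> real vec" where
  "grad n f x = (THE g. has_gradient n f x g)"

definition smooth_fun :: "nat \<Rightarrow> real \<Rightarrow> (real vec \<Rightarrow> real) \<Rightarrow> bool" where
  "smooth_fun n L f \<longleftrightarrow>
     (\<forall>x\<in>carrier_vec n. \<exists>g. has_gradient n f x g) \<and>
     (\<forall>x\<in>carrier_vec n. \<forall>y\<in>carrier_vec n.
        vnorm (grad n f x - grad n f y) \<le> L * vnorm (x - y))"

definition convex_fun :: "nat \<Rightarrow> (real vec \<Rightarrow> real) \<Rightarrow> bool" where
  "convex_fun n f \<longleftrightarrow>
     (\<forall>x\<in>carrier_vec n. \<forall>y\<in>carrier_vec n. \<forall>t. 0 \<le> t \<and> t \<le> 1 \<longrightarrow>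
        f (t \<cdot>\<^sub>v x + (1 - t) \<cdot>\<^sub>v y) \<le> t * f x + (1 - t) * f y)"

definition proper_efun :: "nat \<Rightarrow> (real vec \<Rightarrow> ereal) \<Rightarrow> bool" where
  "proper_efun m h \<longleftrightarrow>
     (\<forall>x\<in>carrier_vec m. h x \<noteq> -\<infinity>) \<and> (\<exists>x\<in>carrier_vec m. h x \<noteq> \<infinity>)"

text \<open>The epigraph is topologically closed: it contains all of its limit points \<open>(x, r)\<close>.\<close>

definition closed_efun :: "nat \<Rightarrow> (real vec \<Rightarrow> ereal) \<Rightarrow> bool" where
  "closed_efun m h \<longleftrightarrow>
     (\<forall>x\<in>carrier_vec m. \<forall>r::real.
        (\<forall>e>0. \<exists>y\<in>carrier_vec m. \<exists>s::real.
           h y \<le> ereal s \<and> vnorm (y - x) < e \<and> \<bar>s - r\<bar> < e) \<longrightarrow> h x \<le> ereal r)"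

text \<open>For proper functions the right-hand side below is never of the form \<open>\<infinity> - \<infinity>\<close>.\<close>

definition convex_efun :: "nat \<Rightarrow> (real vec \<Rightarrow> ereal) \<Rightarrow> bool" where
  "convex_efun m h \<longleftrightarrow>
     (\<forall>x\<in>carrier_vec m. \<forall>y\<in>carrier_vec m. \<forall>t. 0 < t \<and> t < 1 \<longrightarrow>
        h (t \<cdot>\<^sub>v x + (1 - t) \<cdot>\<^sub>v y) \<le> ereal t * h x + ereal (1 - t) * h y)"

definition set_indicator :: "real vec set \<Rightarrow> real vec \<Rightarrow> ereal" where
  "set_indicator S v = (if v \<in> S then 0 else \<infinity>)"

text \<open>Minimise \<open>f(x) + h(Ax - b)\<close>; the dimensions are those of the matrix.\<close>

record problem =
  smooth_part :: "real vec \<Rightarrow> real"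
  comp_part :: "real vec \<Rightarrow> ereal"
  cmat :: "real mat"
  crhs :: "real vec"

abbreviation xdim :: "problem \<Rightarrow> nat" where "xdim P \<equiv> dim_col (cmat P)"
abbreviation cdim :: "problem \<Rightarrow> nat" where "cdim P \<equiv> dim_row (cmat P)"

definition residual :: "problem \<Rightarrow> real vec \<Rightarrow> real vec" where
  "residual P x = cmat P *\<^sub>v x - crhs P"

definition total_obj :: "problem \<Rightarrow> real vec \<Rightarrow> ereal" where
  "total_obj P x = ereal (smooth_part P x) + comp_part P (residual P x)"

text \<open>Finiteness excludes the degenerate case of an infeasible problem.\<close>

definition optimal :: "problem \<Rightarrow> real vec \<Rightarrow> bool" where
  "optimal P x \<longleftrightarrow> x \<in> carrier_vec (xdim P) \<and> total_obj P x \<noteq> \<infinity> \<and>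
     (\<forall>y\<in>carrier_vec (xdim P). total_obj P x \<le> total_obj P y)"

text \<open>The initial point \<open>x\<^sub>0\<close> is the origin.\<close>

definition F_C :: "real \<Rightarrow> real \<Rightarrow> real \<Rightarrow> problem set" where
  "F_C L \<kappa> D = {P.
     0 < xdim P \<and> 0 < cdim P \<and> crhs P \<in> carrier_vec (cdim P) \<and>
     convex_fun (xdim P) (smooth_part P) \<and> smooth_fun (xdim P) L (smooth_part P) \<and>
     proper_efun (cdim P) (comp_part P) \<and> closed_efun (cdim P) (comp_part P) \<and>
     convex_efun (cdim P) (comp_part P) \<and>
     cond_number_le (cmat P) \<kappa> \<and>
     (\<exists>xs. optimal P xs \<and> vnorm (0\<^sub>v (xdim P) - xs) \<le> D)}"

definition eq_constrained :: "problem \<Rightarrow> bool" where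
  "eq_constrained P \<longleftrightarrow> comp_part P = set_indicator {0\<^sub>v (cdim P)}"

definition optimal_dual :: "problem \<Rightarrow> real vec \<Rightarrow> real vec \<Rightarrow> bool" where
  "optimal_dual P xs ls \<longleftrightarrow> ls \<in> carrier_vec (cdim P) \<and>
     (cmat P)\<^sup>T *\<^sub>v ls = grad (xdim P) (smooth_part P) xs"

definition SubOpt_C :: "problem \<Rightarrow> real \<Rightarrow> real vec \<Rightarrow> real" where
  "SubOpt_C P \<rho> x =
     smooth_part P x - Inf (smooth_part P ` {y \<in> carrier_vec (xdim P). cmat P *\<^sub>v y = crhs P})
       + \<rho> * vnorm (residual P x)"

text \<open>
  The set \<open>S\<^sup>x\<^sub>k\<close> generated by the iterates \<open>x\<close>; the query points \<open>z\<close> of step \<open>i\<close> range over all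
  of \<open>S\<^sup>x\<^sub>i\<close>.
\<close>

fun span_set :: "problem \<Rightarrow> (nat \<Rightarrow> real vec) \<Rightarrow> nat \<Rightarrow> real vec set" where
  "span_set P x 0 = vspan (xdim P) {x 0}"
| "span_set P x (Suc k) = vspan (xdim P)
     (\<Union>i\<in>{..k}. {x i}
        \<union> (\<lambda>z. grad (xdim P) (smooth_part P) z) ` span_set P x i
        \<union> (\<lambda>z. (cmat P)\<^sup>T *\<^sub>v residual P z) ` span_set P x i)"

text \<open>
  An algorithm maps every problem instance to its sequence of iterates; the span condition is
  imposed on the instances of the class \<open>\<P>\<close> the algorithm is meant for.
\<close>

definition linear_span_algorithm ::
  "problem set \<Rightarrow> (problem \<Rightarrow> nat \<Rightarrow> real vec) \<Rightarrow> bool" where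
  "linear_span_algorithm \<P> alg \<longleftrightarrow>
     (\<forall>P\<in>\<P>. alg P 0 = 0\<^sub>v (xdim P) \<and> (\<forall>k. alg P k \<in> span_set P (alg P) k))"

end

theory Submission
  imports Defs "Jordan_Normal_Form.Spectral_Radius" "HOL-Analysis.L2_Norm"
begin

text \<open>
  The hard instance is a chain of \<open>d\<close> runs of \<open>n + 1\<close> variables, \<open>n\<close> of order \<open>\<kappa>\<close>. Inside a run the
  constraints \<open>A x = 0\<close> force the end to equal the start; between runs \<open>f\<close> contains a quarter of \<open>L\<close>
  times the squared difference (a link), as in Nesterov's worst-case function. Every step moves the
  support of the iterates by one variable, so crossing a run costs \<open>n + 1\<close> steps. The constraints
  scale the interior of a run by \<open>\<delta> = 1 / sqrt n\<close>: this keeps the norm of the solution within a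
  constant factor of that of the \<open>d\<close> starting values, while the condition number stays \<open>O(n)\<close>.

  In the solution all links have the same value \<open>s\<close>, and \<open>f x - f x\<^sup>\<star> - \<langle>\<lambda>\<^sup>\<star>, A x\<rangle>\<close> equals
  \<open>L / 4\<close> times the sum of \<open>(link - s)\<^sup>2\<close>; by Cauchy-Schwarz it bounds \<open>SubOpt_C\<close> from below.
  Each link out of reach contributes \<open>L / 4 * s\<^sup>2\<close>. With half of the \<open>d = 2 m\<close> runs
  out of reach and \<open>s\<^sup>2 = D\<^sup>2 / (24 m\<^sup>3)\<close>, the bound is \<open>L D\<^sup>2 / (96 m\<^sup>2)\<close> during the first
  \<open>m (n + 1)\<close> steps.
\<close>

section \<open>The Euclidean norm on carrier vectors\<close>

lemma scalar_prod_self_nonneg: "0 \<le> v \<bullet> (v :: real vec)"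
  by (simp add: scalar_prod_def sum_nonneg)

lemma vnorm_L2_set: "v \<in> carrier_vec n \<Longrightarrow> vnorm v = L2_set (\<lambda>i. v $ i) {..<n}"
  by (simp add: vnorm_def L2_set_def scalar_prod_def power2_eq_square lessThan_atLeast0)

lemma vnorm_power2: "v \<in> carrier_vec n \<Longrightarrow> (vnorm v)\<^sup>2 = (\<Sum>i<n. (v $ i)\<^sup>2)"
  by (simp add: vnorm_L2_set L2_set_def sum_nonneg)

lemma vnorm_nonneg: "0 \<le> vnorm v"
  by (simp add: vnorm_def scalar_prod_self_nonneg)

lemma vnorm_power2_scalar_prod: "(vnorm v)\<^sup>2 = v \<bullet> v"
  by (simp add: vnorm_def scalar_prod_self_nonneg)

lemma vnorm_eq_0: "v \<in> carrier_vec n \<Longrightarrow> vnorm v = 0 \<Longrightarrow> v = 0\<^sub>v n"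
  by (intro eq_vecI) (auto simp: vnorm_L2_set L2_set_eq_0_iff)

lemma vnorm_smult: "vnorm (c \<cdot>\<^sub>v v) = \<bar>c\<bar> * vnorm v"
proof -
  have "v \<in> carrier_vec (dim_vec v)" by simp
  then show ?thesis
    by (simp add: vnorm_def real_sqrt_mult flip: mult.assoc power2_eq_square)
qed

lemma scalar_prod_le_vnorm:
  assumes "u \<in> carrier_vec n" "v \<in> carrier_vec n"
  shows "u \<bullet> v \<le> vnorm u * vnorm v"
proof -
  have "u \<bullet> v \<le> (\<Sum>i<n. \<bar>u $ i\<bar> * \<bar>v $ i\<bar>)"
    using assms by (auto simp: scalar_prod_def lessThan_atLeast0 intro!: sum_mono simp flip: abs_mult)
  also have "\<dots> \<le> vnorm u * vnorm v"
    using assms by (simp add: vnorm_L2_set L2_set_mult_ineq)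
  finally show ?thesis .
qed

section \<open>Singular values and the condition number\<close>

text \<open>A complex eigenvalue always exists; symmetry makes it equal to its conjugate, and a real
  root of the complex characteristic polynomial is a root of the real one.\<close>

lemma real_symmetric_eigenvalue_exists:
  fixes M :: "real mat"
  assumes M: "M \<in> carrier_mat n n" and n: "0 < n" and sym: "M\<^sup>T = M"
  shows "\<exists>e. eigenvalue M e"
proof -
  let ?C = "map_mat complex_of_real M"
  have C: "?C \<in> carrier_mat n n" using M by simp
  obtain e v where ev: "eigenvector ?C v e"
    using spectrum_non_empty[OF C n] unfolding spectrum_def eigenvalue_def by auto
  then have v: "v \<in> carrier_vec n" "v \<noteq> 0\<^sub>v n" "?C *\<^sub>v v = e \<cdot>\<^sub>v v"
    using C unfolding eigenvector_def by auto
  have cC: "?C *\<^sub>v conjugate v = conjugate e \<cdot>\<^sub>v conjugate v"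
  proof -
    have "?C *\<^sub>v conjugate v = conjugate (?C *\<^sub>v v)"
      using v(1) M by (auto simp: scalar_prod_def)
    then show ?thesis using v by (simp add: conjugate_smult_vec)
  qed
  have "e * (v \<bullet> conjugate v) = (?C *\<^sub>v v) \<bullet> conjugate v"
    using v by simp
  also have "\<dots> = v \<bullet> (?C\<^sup>T *\<^sub>v conjugate v)"
    using v(1) C by (metis (no_types, lifting) carrier_vec_conjugate transpose_vec_mult_scalar
      transpose_carrier_mat transpose_transpose)
  also have "?C\<^sup>T = ?C" using sym by (metis map_mat_transpose)
  also have "v \<bullet> (?C *\<^sub>v conjugate v) = conjugate e * (v \<bullet> conjugate v)"
    using cC v by simp
  finally have "e = cnj e" using v by simp
  then obtain r where r: "e = complex_of_real r"
    by (metis Reals_cnj_iff Reals_cases)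
  have "poly (char_poly ?C) e = 0"
    using ev C eigenvalue_root_char_poly[OF C, of e] unfolding eigenvalue_def by auto
  then have "poly (char_poly M) r = 0"
    unfolding r of_real_hom.char_poly_hom[OF M] by simp
  then show ?thesis using eigenvalue_root_char_poly[OF M] by blast
qed

text \<open>For \<open>m \<le> n\<close> the relevant Gram matrix is \<open>A * A\<^sup>T\<close>.
  An eigenvector \<open>v\<close> for \<open>e\<close> satisfies \<open>(vnorm (A\<^sup>T *\<^sub>v
  v))\<^sup>2 = e * (vnorm v)\<^sup>2\<close>, so a lower bound on the transpose bounds every
  singular value.\<close>

lemma cond_number_leI:
  assumes A: "A \<in> carrier_mat m n" and m: "0 < m" "m \<le> n" and \<sigma>: "0 < \<sigma>" and C: "0 \<le> C" "C \<le> \<kappa> * \<sigma>"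
    and up: "\<And>x. x \<in> carrier_vec n \<Longrightarrow> vnorm (A *\<^sub>v x) \<le> C * vnorm x"
    and low: "\<And>y. y \<in> carrier_vec m \<Longrightarrow> \<sigma> * vnorm y \<le> vnorm (A\<^sup>T *\<^sub>v y)"
  shows "cond_number_le A \<kappa>"
proof -
  let ?G = "A * A\<^sup>T"
  have G: "?G \<in> carrier_mat m m" using A by simp
  have sv: "singular_values A = sqrt ` {e. eigenvalue ?G e}"
    using A m by (simp add: singular_values_def)
  have fin: "finite {e. eigenvalue ?G e}"
    using card_finite_spectrum(1)[OF G] by (simp add: spectrum_def)
  \<comment> \<open>The set of eigenvalues must be nonempty for \<open>Min\<close> to be
    meaningful.\<close>
  have "?G\<^sup>T = ?G" using A by (simp add: transpose_mult)
  then obtain e0 where "eigenvalue ?G e0"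
    using real_symmetric_eigenvalue_exists[OF G m(1)] by blast
  then have ne: "{e. eigenvalue ?G e} \<noteq> {}" by blast
  have ge: "\<sigma> \<le> sqrt e" if ev: "eigenvalue ?G e" for e
  proof -
    obtain v where "eigenvector ?G v e" using ev unfolding eigenvalue_def by auto
    then have v: "v \<in> carrier_vec m" "v \<noteq> 0\<^sub>v m" "?G *\<^sub>v v = e \<cdot>\<^sub>v v"
      using A unfolding eigenvector_def by auto
    have pos: "0 < vnorm v" using v vnorm_eq_0 vnorm_nonneg[of v] by fastforce
    have w: "A\<^sup>T *\<^sub>v v \<in> carrier_vec n" using A v by simp
    have "(vnorm (A\<^sup>T *\<^sub>v v))\<^sup>2 = (A\<^sup>T *\<^sub>v v) \<bullet> (A\<^sup>T *\<^sub>v v)"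
      by (rule vnorm_power2_scalar_prod)
    also have "\<dots> = v \<bullet> (A *\<^sub>v (A\<^sup>T *\<^sub>v v))"
      by (rule transpose_vec_mult_scalar[OF A w v(1)])
    also have "A *\<^sub>v (A\<^sup>T *\<^sub>v v) = e \<cdot>\<^sub>v v"
      using A v by (metis assoc_mult_mat_vec transpose_carrier_mat)
    finally have eq: "(vnorm (A\<^sup>T *\<^sub>v v))\<^sup>2 = e * (vnorm v)\<^sup>2"
      using v by (simp add: vnorm_power2_scalar_prod)
    have "\<sigma>\<^sup>2 * (vnorm v)\<^sup>2 \<le> e * (vnorm v)\<^sup>2"
      using power_mono[OF low[OF v(1)], of 2] \<sigma> vnorm_nonneg[of v] eq by (simp add: power_mult_distrib)
    then have "\<sigma>\<^sup>2 \<le> e" using pos by simp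
    then show ?thesis by (simp add: real_le_rsqrt)
  qed
  have min: "\<sigma> \<le> min_singular_value A"
    unfolding min_singular_value_def sv using fin ne ge by (subst Min_ge_iff) auto
  have op: "op_norm A \<le> C"
    unfolding op_norm_def
  proof (rule cSup_least)
    have "vnorm (0\<^sub>v n) \<le> 1" by (simp add: vnorm_def)
    then show "{vnorm (A *\<^sub>v x) |x. x \<in> carrier_vec (dim_col A) \<and> vnorm x \<le> 1} \<noteq> {}"
      using A by (auto intro!: exI[of _ "0\<^sub>v n"])
  next
    fix r assume "r \<in> {vnorm (A *\<^sub>v x) |x. x \<in> carrier_vec (dim_col A) \<and> vnorm x \<le> 1}"
    then obtain x where x: "r = vnorm (A *\<^sub>v x)" "x \<in> carrier_vec n" "vnorm x \<le> 1" using A by auto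
    show "r \<le> C" using up[OF x(2)] x(1) mult_left_mono[OF x(3) C(1)] by simp
  qed
  have "0 \<le> \<kappa>" using C \<sigma> by (smt (verit) mult_neg_pos)
  then have "C \<le> \<kappa> * min_singular_value A"
    using C(2) mult_left_mono[OF min, of \<kappa>] by linarith
  then show ?thesis
    unfolding cond_number_le_def using \<sigma> min op by (simp add: divide_le_eq)
qed

section \<open>Gradients and coordinate subspaces\<close>

text \<open>Both expansions are tested along \<open>w = g - h\<close>: their difference is
  \<open>t * (vnorm w)\<^sup>2\<close>, yet at most \<open>e * t * vnorm w\<close>. Uniqueness gives
  meaning to the \<open>THE\<close> in \<open>grad\<close>.\<close>

lemma has_gradient_unique:
  assumes x: "x \<in> carrier_vec n" and g: "has_gradient n f x g" and h: "has_gradient n f x h"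
  shows "g = h"
proof -
  have gc: "g \<in> carrier_vec n" and hc: "h \<in> carrier_vec n" using g h by (auto simp: has_gradient_def)
  define w where "w = g - h"
  have w: "w \<in> carrier_vec n" using gc hc by (simp add: w_def)
  have "vnorm w \<le> 0"
  proof (rule field_le_epsilon)
    fix e :: real assume e: "0 < e"
    obtain d1 where d1: "d1 > 0" "\<And>y. y \<in> carrier_vec n \<Longrightarrow> vnorm (y - x) < d1 \<Longrightarrow>
        \<bar>f y - f x - g \<bullet> (y - x)\<bar> \<le> e/2 * vnorm (y - x)"
      using g e unfolding has_gradient_def by (meson half_gt_zero)
    obtain d2 where d2: "d2 > 0" "\<And>y. y \<in> carrier_vec n \<Longrightarrow> vnorm (y - x) < d2 \<Longrightarrow>
        \<bar>f y - f x - h \<bullet> (y - x)\<bar> \<le> e/2 * vnorm (y - x)"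
      using h e unfolding has_gradient_def by (meson half_gt_zero)
    \<comment> \<open>Small enough to stay inside both neighbourhoods; the summand 1 keeps the
      denominator positive if \<open>w\<close> vanishes.\<close>
    define t where "t = min d1 d2 / (2 * (1 + vnorm w))"
    have t: "t > 0" using d1 d2 vnorm_nonneg[of w] by (simp add: t_def add_pos_nonneg)
    define y where "y = x + t \<cdot>\<^sub>v w"
    have y: "y \<in> carrier_vec n" using x w by (simp add: y_def)
    have yx: "y - x = t \<cdot>\<^sub>v w" using x w by (intro eq_vecI) (auto simp: y_def)
    have nyx: "vnorm (y - x) = t * vnorm w" using t by (simp add: yx vnorm_smult)
    have "t * vnorm w < min d1 d2"
    proof -
      have "t * vnorm w \<le> t * (1 + vnorm w)" using t by simp
      also have "\<dots> = min d1 d2 / 2" using vnorm_nonneg[of w] by (simp add: t_def field_simps)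
      finally show ?thesis using d1 d2 by linarith
    qed
    then have "\<bar>f y - f x - g \<bullet> (y - x)\<bar> \<le> e/2 * (t * vnorm w)"
      "\<bar>f y - f x - h \<bullet> (y - x)\<bar> \<le> e/2 * (t * vnorm w)"
      using d1(2)[OF y] d2(2)[OF y] nyx by auto
    then have "g \<bullet> (y - x) - h \<bullet> (y - x) \<le> e * (t * vnorm w)" by linarith
    moreover have "g \<bullet> (y - x) - h \<bullet> (y - x) = t * (vnorm w)\<^sup>2"
      using gc hc w by (simp add: yx vnorm_power2_scalar_prod w_def minus_scalar_prod_distrib[of g n h]
          algebra_simps)
    ultimately have "vnorm w * vnorm w \<le> e * vnorm w" using t by (simp add: power2_eq_square)
    then show "vnorm w \<le> 0 + e" using vnorm_nonneg[of w] e
      by (smt (verit) mult_right_less_imp_less mult_strict_right_mono)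
  qed
  then have "w = 0\<^sub>v n" using vnorm_eq_0[OF w] vnorm_nonneg[of w] by simp
  then show ?thesis using gc hc unfolding w_def
    by (metis add.left_neutral index_minus_vec(1) index_zero_vec(1) eq_iff_diff_eq_0 eq_vecI carrier_vecD)
qed

lemma grad_eqI: "x \<in> carrier_vec n \<Longrightarrow> has_gradient n f x g \<Longrightarrow> grad n f x = g"
  unfolding grad_def by (rule the_equality) (auto dest: has_gradient_unique)

lemma has_gradient_quadratic:
  assumes "g \<in> carrier_vec n" and C: "0 \<le> C"
    and q: "\<And>y. y \<in> carrier_vec n \<Longrightarrow> \<bar>f y - f x - g \<bullet> (y - x)\<bar> \<le> C * (vnorm (y - x))\<^sup>2"
  shows "has_gradient n f x g"
  unfolding has_gradient_def
proof (intro conjI allI impI)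
  fix e :: real assume e: "0 < e"
  show "\<exists>d>0. \<forall>y\<in>carrier_vec n. vnorm (y - x) < d \<longrightarrow> \<bar>f y - f x - g \<bullet> (y - x)\<bar> \<le> e * vnorm (y - x)"
  proof (intro exI[of _ "e / (C + 1)"] conjI ballI impI)
    fix y assume y: "y \<in> carrier_vec n" and lt: "vnorm (y - x) < e / (C + 1)"
    have "C * vnorm (y - x) \<le> (C + 1) * vnorm (y - x)" using vnorm_nonneg by (simp add: mult_right_mono)
    also have "\<dots> \<le> e" using lt C by (simp add: field_simps)
    finally have "C * vnorm (y - x) * vnorm (y - x) \<le> e * vnorm (y - x)"
      using vnorm_nonneg by (rule mult_right_mono)
    then show "\<bar>f y - f x - g \<bullet> (y - x)\<bar> \<le> e * vnorm (y - x)"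
      using q[OF y] by (simp add: power2_eq_square mult.assoc)
  qed (use e C in simp)
qed (use assms in simp)

text \<open>\<open>W\<close> is a variable tied by an equation so that \<open>shallow_def\<close>
  can be plugged in directly.\<close>

lemma vspan_subset:
  assumes S: "S \<subseteq> W" and W: "W = {v \<in> carrier_vec n. \<forall>i<n. Z i \<longrightarrow> v $ i = 0}"
  shows "vspan n S \<subseteq> W"
proof -
  interpret vec_space "TYPE(real)" n .
  have "submodule class_ring W V"
    unfolding submodule_def using W by (auto simp: module_vec_simps class_ring_simps vec_module)
  then show ?thesis using span_is_subset S by blast
qed

section \<open>The indicator function of the origin\<close>

lemma proper_efun_set_indicator_0: "proper_efun m (set_indicator {0\<^sub>v m})"
  unfolding proper_efun_def set_indicator_def by auto

lemma convex_efun_set_indicator_0: "convex_efun m (set_indicator {0\<^sub>v m})"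
  unfolding convex_efun_def set_indicator_def by auto

lemma closed_efun_set_indicator_0: "closed_efun m (set_indicator {0\<^sub>v m})"
  unfolding closed_efun_def
proof (intro ballI allI impI)
  fix x :: "real vec" and r :: real
  assume x: "x \<in> carrier_vec m"
    and lim: "\<forall>e>0. \<exists>y\<in>carrier_vec m. \<exists>s::real.
      set_indicator {0\<^sub>v m} y \<le> ereal s \<and> vnorm (y - x) < e \<and> \<bar>s - r\<bar> < e"
  have near: "vnorm x < e \<and> - e < r" if e: "e > 0" for e
  proof -
    obtain y s where y: "y \<in> carrier_vec m" "set_indicator {0\<^sub>v m} y \<le> ereal s" "vnorm (y - x) < e" "\<bar>s - r\<bar> < e"
      using lim e by blast
    then have 0: "y = 0\<^sub>v m" "0 \<le> s" by (auto simp: set_indicator_def split: if_splits)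
    have "y - x = (-1) \<cdot>\<^sub>v x" using x 0 by (intro eq_vecI) auto
    then show ?thesis using y 0 by (simp add: vnorm_smult)
  qed
  have "vnorm x \<le> 0" using near by (meson less_le_not_le not_le)
  moreover have "0 \<le> r" using near[of "- r"] by force
  ultimately show "set_indicator {0\<^sub>v m} x \<le> ereal r"
    using vnorm_eq_0[OF x] vnorm_nonneg[of x] by (simp add: set_indicator_def)
qed

section \<open>Inequalities and regroupings for finite sums\<close>

text \<open>A discrete Poincare inequality: \<open>u i\<close> is \<open>u 0\<close> plus the
  differences, and Cauchy-Schwarz with weight \<open>n\<close> on \<open>u 0\<close> gives the
  factor \<open>n + i\<close>. It bounds the smallest singular value of the chain.\<close>

lemma sum_squares_le_differences:
  fixes u :: "nat \<Rightarrow> real"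
  assumes n: "0 < n"
  shows "(\<Sum>i<n. (u i)\<^sup>2) \<le> 2 * (real n)\<^sup>2 * ((u 0)\<^sup>2 / n + (\<Sum>l<n-1. (u (Suc l) - u l)\<^sup>2))"
proof -
  define E where "E i = (u 0)\<^sup>2 / n + (\<Sum>l<i. (u (Suc l) - u l)\<^sup>2)" for i
  have bound: "(u i)\<^sup>2 \<le> (n + i) * E i" for i
  proof (induction i)
    case 0
    then show ?case using n by (simp add: E_def)
  next
    case (Suc i)
    define K where "K = real (n + i)"
    define v where "v = u (Suc i) - u i"
    have K: "K > 0" using n by (simp add: K_def)
    \<comment> \<open>This is Cauchy-Schwarz for one step: \<open>(p + v)\<^sup>2 \<le> (1 + 1/K) *
      p\<^sup>2 + (K + 1) * v\<^sup>2\<close>, multiplied by \<open>K\<close>.\<close>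
    have "0 \<le> (u i - K * v)\<^sup>2" by simp
    then have "K * (u i + v)\<^sup>2 \<le> (K + 1) * (u i)\<^sup>2 + K * (K + 1) * v\<^sup>2"
      by (simp add: power2_eq_square algebra_simps)
    also have "\<dots> \<le> (K + 1) * (K * E i) + K * (K + 1) * v\<^sup>2"
      using Suc K by (intro add_right_mono mult_left_mono) (auto simp: K_def)
    also have "\<dots> = K * ((K + 1) * E (Suc i))" by (simp add: E_def v_def algebra_simps)
    finally show ?case using K by (simp add: v_def) (simp add: K_def algebra_simps)
  qed
  have "(u i)\<^sup>2 \<le> 2 * n * E (n - 1)" if "i < n" for i
  proof -
    have "E i \<le> E (n - 1)" unfolding E_def using that by (intro add_left_mono sum_mono2) auto
    moreover have "0 \<le> E i" by (simp add: E_def sum_nonneg)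
    ultimately have "(n + i) * E i \<le> (2 * n) * E (n - 1)"
      using that by (intro mult_mono) auto
    then show ?thesis using bound[of i] by simp
  qed
  then have "(\<Sum>i<n. (u i)\<^sup>2) \<le> n * (2 * n * E (n - 1))"
    using sum_bounded_above[of "{..<n}" "\<lambda>i. (u i)\<^sup>2"] by auto
  then show ?thesis by (simp add: E_def power2_eq_square mult.assoc mult.left_commute)
qed

lemma power2_diff_le: "(p - q)\<^sup>2 \<le> 2 * p\<^sup>2 + 2 * q\<^sup>2" for p q :: real
  using zero_le_power2[of "p + q"] by (simp add: power2_eq_square algebra_simps)

lemma sum_lessThan_add:
  fixes g :: "nat \<Rightarrow> real"
  shows "(\<Sum>c<m + k. g c) = (\<Sum>c<m. g c) + (\<Sum>j<k. g (m + j))"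
  by (induction k) auto

text \<open>With the column numbering used below, \<open>j\<close> is the run and \<open>i\<close>
  the position in it, so estimates can be made run by run.\<close>

lemma sum_lessThan_mult:
  fixes g :: "nat \<Rightarrow> real"
  shows "(\<Sum>c<k * d. g c) = (\<Sum>j<d. \<Sum>i<k. g (i * d + j))"
proof (induction k)
  case (Suc k)
  have "(\<Sum>c<Suc k * d. g c) = (\<Sum>c<k * d. g c) + (\<Sum>j<d. g (k * d + j))"
    using sum_lessThan_add[of g "k * d" d] by (simp add: add.commute)
  then show ?case by (simp add: Suc sum.distrib)
qed simp

text \<open>
  The column \<open>i * d + j\<close> with \<open>i \<le> n\<close> and \<open>j < d\<close> is the \<open>i\<close>-th variable of the \<open>j\<close>-th run, so that the
  row \<open>r\<close> of the constraint matrix couples the columns \<open>r\<close> and \<open>r + d\<close>. The parameter \<open>s\<close> is the drop of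
  the solution from one run to the next.
\<close>

locale chain =
  fixes n d :: nat and L s :: real
  assumes n: "0 < n" and d: "0 < d" and L: "0 < L"
begin

section \<open>The constraint matrix and its conditioning\<close>

definition \<delta> :: real where "\<delta> = 1 / sqrt (real n)"

lemma \<delta>: "0 < \<delta>" "\<delta> \<le> 1" "\<delta>\<^sup>2 = 1 / real n"
  using n by (auto simp: \<delta>_def power_divide)

abbreviation "nr \<equiv> n * d"
abbreviation "nc \<equiv> n * d + d"

lemma d_le_nr: "d \<le> nr"
  using n by simp

text \<open>Only the first and the last constraint of a run carry \<open>\<delta>\<close>: one
  enters the scaled interior, the other leaves it. For \<open>n = 1\<close> they coincide and
  \<open>\<delta> = 1\<close>.\<close>

definition a :: "nat \<Rightarrow> real" where "a c = (if c < d then \<delta> else 1)"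
definition b :: "nat \<Rightarrow> real" where "b r = (if r + d < n * d then 1 else \<delta>)"

lemma a_le: "(a c)\<^sup>2 \<le> 1" and b_le: "(b c)\<^sup>2 \<le> 1"
  using \<delta> by (auto simp: a_def b_def power_le_one)

definition A :: "real mat" where
  "A = mat nr nc (\<lambda>(r, c). if c = r then a r else if c = r + d then - b r else 0)"

lemma A_carrier: "A \<in> carrier_mat nr nc"
  by (simp add: A_def)

lemma A_dim [simp]: "dim_row A = nr" "dim_col A = nc"
  by (simp_all add: A_def)

lemma A_mult:
  assumes x: "x \<in> carrier_vec nc" and r: "r < nr"
  shows "(A *\<^sub>v x) $ r = a r * x $ r - b r * x $ (r + d)"
proof -
  have "(A *\<^sub>v x) $ r = (\<Sum>c<nc. (if c = r then a r else if c = r + d then - b r else 0) * x $ c)"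
    using x r by (simp add: A_def scalar_prod_def lessThan_atLeast0)
  also have "\<dots> = (\<Sum>c<nc. (if c = r then a r * x $ c else 0) + (if c = r + d then - b r * x $ c else 0))"
    using d by (intro sum.cong) auto
  also have "\<dots> = a r * x $ r - b r * x $ (r + d)"
    using r by (simp add: sum.distrib)
  finally show ?thesis .
qed

lemma A_transpose_mult:
  assumes y: "y \<in> carrier_vec nr" and c: "c < nc"
  shows "(A\<^sup>T *\<^sub>v y) $ c = (if c < nr then a c * y $ c else 0) - (if d \<le> c then b (c - d) * y $ (c - d) else 0)"
proof -
  have "(A\<^sup>T *\<^sub>v y) $ c = (\<Sum>r<nr. (if c = r then a r else if c = r + d then - b r else 0) * y $ r)"
    using y c by (simp add: A_def scalar_prod_def lessThan_atLeast0)
  also have "\<dots> = (\<Sum>r<nr. (if r = c then a r * y $ r else 0)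
      + (if r = c - d then if d \<le> c then - b r * y $ r else 0 else 0))"
    using d by (intro sum.cong) auto
  also have "\<dots> = (if c < nr then a c * y $ c else 0) - (if d \<le> c then b (c - d) * y $ (c - d) else 0)"
    using c less_diff_conv2[of d c nr] by (simp add: sum.distrib)
  finally show ?thesis .
qed

text \<open>A column meets at most two rows, which gives 4 after splitting the squares. For
  \<open>n = 1\<close> it meets only one; this sharper constant is needed to reach condition number
  1.\<close>

lemma A_norm:
  assumes x: "x \<in> carrier_vec nc"
  shows "(vnorm (A *\<^sub>v x))\<^sup>2 \<le> (if n = 1 then 2 else 4) * (vnorm x)\<^sup>2"
proof -
  have "A *\<^sub>v x \<in> carrier_vec nr" using A_carrier x by simp
  then have "(vnorm (A *\<^sub>v x))\<^sup>2 = (\<Sum>r<nr. (a r * x $ r - b r * x $ (r + d))\<^sup>2)"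
    by (simp add: vnorm_power2[of _ nr] A_mult[OF x] del: index_mult_mat_vec)
  also have "\<dots> \<le> (\<Sum>r<nr. 2 * (x $ r)\<^sup>2 + 2 * (x $ (r + d))\<^sup>2)"
  proof (rule sum_mono)
    fix r
    have "(a r * x $ r - b r * x $ (r + d))\<^sup>2 \<le> 2 * ((a r)\<^sup>2 * (x $ r)\<^sup>2) + 2 * ((b r)\<^sup>2 * (x $ (r + d))\<^sup>2)"
      using power2_diff_le[of "a r * x $ r" "b r * x $ (r + d)"] by (simp flip: power_mult_distrib)
    also have "\<dots> \<le> 2 * (x $ r)\<^sup>2 + 2 * (x $ (r + d))\<^sup>2"
      using mult_right_mono[OF a_le, of "(x $ r)\<^sup>2"] mult_right_mono[OF b_le, of "(x $ (r + d))\<^sup>2"]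
      by (simp add: add_mono)
    finally show "(a r * x $ r - b r * x $ (r + d))\<^sup>2 \<le> 2 * (x $ r)\<^sup>2 + 2 * (x $ (r + d))\<^sup>2" .
  qed
  also have "\<dots> = 2 * (\<Sum>r<nr. (x $ r)\<^sup>2) + 2 * (\<Sum>r<nr. (x $ (d + r))\<^sup>2)"
    by (simp add: sum.distrib sum_distrib_left add.commute)
  also have "\<dots> \<le> (if n = 1 then 2 else 4) * (\<Sum>c<nc. (x $ c)\<^sup>2)"
  proof (cases "n = 1")
    case True
    then show ?thesis using sum_lessThan_add[of "\<lambda>c. (x $ c)\<^sup>2" nr d] by simp
  next
    case False
    have "(\<Sum>c<nc. (x $ c)\<^sup>2) = (\<Sum>r<nr. (x $ r)\<^sup>2) + (\<Sum>j<d. (x $ (nr + j))\<^sup>2)"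
      by (rule sum_lessThan_add)
    moreover have "(\<Sum>c<nc. (x $ c)\<^sup>2) = (\<Sum>j<d. (x $ j)\<^sup>2) + (\<Sum>r<nr. (x $ (d + r))\<^sup>2)"
      using sum_lessThan_add[of "\<lambda>c. (x $ c)\<^sup>2" d nr] by (simp add: add.commute)
    moreover have "0 \<le> (\<Sum>j<d. (x $ (nr + j))\<^sup>2)" "0 \<le> (\<Sum>j<d. (x $ j)\<^sup>2)"
      by (simp_all add: sum_nonneg)
    ultimately show ?thesis using False by simp
  qed
  finally show ?thesis by (simp add: vnorm_power2[OF x])
qed

lemma A_transpose_norm:
  assumes y: "y \<in> carrier_vec nr"
  shows "(if n = 1 then 2 else 1 / (2 * (real n)\<^sup>2)) * (vnorm y)\<^sup>2 \<le> (vnorm (A\<^sup>T *\<^sub>v y))\<^sup>2"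
proof -
  have "A\<^sup>T *\<^sub>v y \<in> carrier_vec nc" using A_carrier y by simp
  then have At: "(vnorm (A\<^sup>T *\<^sub>v y))\<^sup>2 = (\<Sum>c<nc. ((A\<^sup>T *\<^sub>v y) $ c)\<^sup>2)"
    by (rule vnorm_power2)
  show ?thesis
  proof (cases "n = 1")
    case True
    have 1: "\<delta> = 1" by (unfold \<delta>_def) (simp add: True)
    have nd: "nr = d" using True by simp
    have "(A\<^sup>T *\<^sub>v y) $ c = y $ c" if "c < d" for c
      using A_transpose_mult[OF y, of c] that 1 d_le_nr by (simp add: a_def del: index_mult_mat_vec)
    moreover have "(A\<^sup>T *\<^sub>v y) $ (nr + j) = - y $ j" if "j < d" for j
    proof -
      have "nr + j - d = j" "\<not> j + d < nr" using nd by auto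
      then show ?thesis
        using A_transpose_mult[OF y, of "nr + j"] that 1 d_le_nr by (simp add: b_def del: index_mult_mat_vec)
    qed
    ultimately have "(\<Sum>c<nc. ((A\<^sup>T *\<^sub>v y) $ c)\<^sup>2) = (\<Sum>c<d. (y $ c)\<^sup>2) + (\<Sum>j<d. (y $ j)\<^sup>2)"
      unfolding sum_lessThan_add by (simp add: nd del: index_mult_mat_vec)
    then show ?thesis using True At by (simp add: vnorm_power2[OF y])
  next
    case False
    have "(vnorm y)\<^sup>2 = (\<Sum>j<d. \<Sum>i<n. (y $ (i * d + j))\<^sup>2)"
      by (simp add: vnorm_power2[OF y] sum_lessThan_mult)
    also have "\<dots> \<le> (\<Sum>j<d. 2 * (real n)\<^sup>2 *
        ((y $ j)\<^sup>2 / n + (\<Sum>l<n - 1. (y $ (d + (l * d + j)) - y $ (l * d + j))\<^sup>2)))"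
      using sum_squares_le_differences[OF n, of "\<lambda>i. y $ (i * d + j)" for j]
      by (intro sum_mono) (simp add: add.assoc)
    also have "\<dots> = 2 * (real n)\<^sup>2 * ((\<Sum>j<d. (y $ j)\<^sup>2 / n) + (\<Sum>r<(n - 1) * d. (y $ (d + r) - y $ r)\<^sup>2))"
      unfolding sum_lessThan_mult by (simp only: sum.distrib flip: sum_distrib_left)
    also have "(\<Sum>j<d. (y $ j)\<^sup>2 / n) + (\<Sum>r<(n - 1) * d. (y $ (d + r) - y $ r)\<^sup>2)
        = (\<Sum>c<d + (n - 1) * d. ((A\<^sup>T *\<^sub>v y) $ c)\<^sup>2)"
    proof -
      have eq: "nr = d + (n - 1) * d" using n by (cases n) auto
      have "(A\<^sup>T *\<^sub>v y) $ c = \<delta> * y $ c" if "c < d" for c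
        using A_transpose_mult[OF y, of c] that d_le_nr by (simp add: a_def del: index_mult_mat_vec)
      moreover have "(A\<^sup>T *\<^sub>v y) $ (d + r) = y $ (d + r) - y $ r" if "r < (n - 1) * d" for r
      proof -
        have "d + r < nr" "r + d < nr" using that eq by linarith+
        then show ?thesis
          using A_transpose_mult[OF y, of "d + r"] by (simp add: a_def b_def del: index_mult_mat_vec)
      qed
      ultimately show ?thesis unfolding sum_lessThan_add
        by (simp add: \<delta>(3) power_mult_distrib del: index_mult_mat_vec)
    qed
    also have "\<dots> \<le> (\<Sum>c<nc. ((A\<^sup>T *\<^sub>v y) $ c)\<^sup>2)"
    proof (rule sum_mono2)
      have "d + (n - 1) * d \<le> nc" by (cases n) auto
      then show "{..<d + (n - 1) * d} \<subseteq> {..<nc}" by auto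
    qed auto
    finally have "(vnorm y)\<^sup>2 \<le> 2 * (real n)\<^sup>2 * (vnorm (A\<^sup>T *\<^sub>v y))\<^sup>2"
      using n by (simp add: At)
    then show ?thesis using False n by (simp add: divide_le_eq mult.commute)
  qed
qed

text \<open>For \<open>n = 1\<close> both bounds are \<open>sqrt 2\<close> and the quotient is 1;
  otherwise it is \<open>2 * sqrt 2 * n\<close>, which is at most \<open>3 * n\<close>.\<close>

lemma cond_number_le_A:
  assumes "1 \<le> \<kappa>" "n = 1 \<or> 3 * real n \<le> \<kappa>"
  shows "cond_number_le A \<kappa>"
proof -
  define C where "C = sqrt (if n = 1 then 2 else 4)"
  define \<sigma> where "\<sigma> = sqrt (if n = 1 then 2 else 1 / (2 * (real n)\<^sup>2))"
  have \<sigma>: "0 < \<sigma>" using n by (simp add: \<sigma>_def)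
  have "C \<le> \<kappa> * \<sigma>"
  proof (cases "n = 1")
    case False
    have "C = 2" using False real_sqrt_abs[of 2] by (simp add: C_def)
    moreover have "2 / 3 \<le> sqrt (1 / 2)" by (rule real_le_rsqrt) (simp add: power2_eq_square)
    then have "2 \<le> 3 * n * \<sigma>"
      using False n by (simp add: \<sigma>_def real_sqrt_divide real_sqrt_mult field_simps)
    moreover have "3 * n * \<sigma> \<le> \<kappa> * \<sigma>" using assms False \<sigma> by simp
    ultimately show ?thesis by linarith
  qed (use assms in \<open>simp add: C_def \<sigma>_def\<close>)
  moreover have "vnorm (A *\<^sub>v x) \<le> C * vnorm x" if "x \<in> carrier_vec nc" for x
    using real_sqrt_le_mono[OF A_norm[OF that]] vnorm_nonneg
    by (simp only: real_sqrt_mult real_sqrt_abs C_def abs_of_nonneg)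
  moreover have "\<sigma> * vnorm y \<le> vnorm (A\<^sup>T *\<^sub>v y)" if "y \<in> carrier_vec nr" for y
    using real_sqrt_le_mono[OF A_transpose_norm[OF that]] vnorm_nonneg
    by (simp only: real_sqrt_mult real_sqrt_abs \<sigma>_def abs_of_nonneg)
  ultimately show ?thesis
    using A_carrier n d \<sigma> by (intro cond_number_leI[of A nr nc \<sigma> C]) (auto simp: C_def)
qed

section \<open>The smooth part: gradient, smoothness, convexity\<close>

text \<open>The run after the last one is held at zero; this is what the missing second term means.\<close>

definition link :: "nat \<Rightarrow> real vec \<Rightarrow> real" where
  "link j x = x $ (n * d + j) - (if Suc j < d then x $ Suc j else 0)"

definition obj :: "real vec \<Rightarrow> real" where
  "obj x = L / 4 * (\<Sum>j<d. (link j x)\<^sup>2) - L / 2 * s * x $ 0"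

definition obj_grad :: "real vec \<Rightarrow> real vec" where
  "obj_grad x = vec nc (\<lambda>c. L / 2 * ((if nr \<le> c then link (c - nr) x else 0)
     - (if 0 < c \<and> c < d then link (c - 1) x else 0) - (if c = 0 then s else 0)))"

definition prob :: problem where
  "prob = \<lparr>smooth_part = obj, comp_part = set_indicator {0\<^sub>v nr}, cmat = A, crhs = 0\<^sub>v nr\<rparr>"

lemma obj_grad_carrier: "obj_grad x \<in> carrier_vec nc"
  by (simp add: obj_grad_def)

lemma Suc_less_nc: "Suc j < d \<Longrightarrow> Suc j < nc"
  by simp

lemma link_diff:
  assumes "x \<in> carrier_vec nc" "y \<in> carrier_vec nc" "j < d"
  shows "link j (x - y) = link j x - link j y"
  using assms by (auto simp: link_def)

lemma link_convex_comb:
  assumes "x \<in> carrier_vec nc" "y \<in> carrier_vec nc" "j < d"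
  shows "link j (t \<cdot>\<^sub>v x + t' \<cdot>\<^sub>v y) = t * link j x + t' * link j y"
  using assms by (auto simp: link_def algebra_simps)

text \<open>The left side pairs \<open>x\<close> with the adjoint of the link map applied to
  \<open>g\<close>: link \<open>j\<close> enters column \<open>nr + j\<close> positively and column
  \<open>Suc j\<close>, if that run exists, negatively.\<close>

lemma sum_link:
  fixes g :: "nat \<Rightarrow> real"
  shows "(\<Sum>c<nc. ((if nr \<le> c then g (c - nr) else 0) - (if 0 < c \<and> c < d then g (c - 1) else 0)) * x $ c)
    = (\<Sum>j<d. g j * link j x)"
proof -
  have 1: "(\<Sum>c<nc. (if nr \<le> c then g (c - nr) else 0) * x $ c) = (\<Sum>j<d. g j * x $ (nr + j))"
    unfolding sum_lessThan_add by simp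
  have "(\<Sum>c<nc. (if 0 < c \<and> c < d then g (c - 1) else 0) * x $ c)
      = (\<Sum>c<d. (if 0 < c then g (c - 1) else 0) * x $ c)"
    by (intro sum.mono_neutral_cong_right) auto
  also have "\<dots> = (\<Sum>j<d. g j * (if Suc j < d then x $ Suc j else 0))"
  proof -
    obtain d' where d': "d = Suc d'" using d by (cases d) auto
    have "(\<Sum>c<Suc d'. (if 0 < c then g (c - 1) else 0) * x $ c) = (\<Sum>j<d'. g j * x $ Suc j)"
      by (subst sum.lessThan_Suc_shift) simp
    then show ?thesis unfolding d' by simp
  qed
  finally show ?thesis using 1
    by (simp add: link_def left_diff_distrib right_diff_distrib sum_subtractf)
qed

lemma obj_grad_scalar_prod:
  assumes h: "h \<in> carrier_vec nc"
  shows "obj_grad x \<bullet> h = L / 2 * (\<Sum>j<d. link j x * link j h) - L / 2 * s * h $ 0"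
proof -
  have "obj_grad x \<bullet> h = (\<Sum>c<nc. obj_grad x $ c * h $ c)"
    using h by (simp add: scalar_prod_def lessThan_atLeast0)
  also have "\<dots> = (\<Sum>c<nc. L / 2 * (((if nr \<le> c then link (c - nr) x else 0)
      - (if 0 < c \<and> c < d then link (c - 1) x else 0)) * h $ c) - (if c = 0 then L / 2 * s * h $ 0 else 0))"
    by (intro sum.cong) (auto simp: obj_grad_def algebra_simps)
  also have "\<dots> = L / 2 * (\<Sum>j<d. link j x * link j h) - L / 2 * s * h $ 0"
    using d by (simp only: sum_subtractf sum_link[of "\<lambda>j. link j x"] flip: sum_distrib_left) simp
  finally show ?thesis .
qed

text \<open>Starts and ends of runs are different columns, so each coordinate occurs in at most one
  link. The factor 2 is what makes \<open>L / 4\<close> times the sum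
  \<open>L\<close>-smooth.\<close>

lemma sum_link_power2_le:
  assumes h: "h \<in> carrier_vec nc"
  shows "(\<Sum>j<d. (link j h)\<^sup>2) \<le> 2 * (vnorm h)\<^sup>2"
proof -
  have "(\<Sum>j<d. (link j h)\<^sup>2) \<le> (\<Sum>j<d. 2 * (h $ (nr + j))\<^sup>2 + 2 * (if Suc j < d then (h $ Suc j)\<^sup>2 else 0))"
  proof (rule sum_mono)
    fix j
    from power2_diff_le[of "h $ (nr + j)" "if Suc j < d then h $ Suc j else 0"]
    show "(link j h)\<^sup>2 \<le> 2 * (h $ (nr + j))\<^sup>2 + 2 * (if Suc j < d then (h $ Suc j)\<^sup>2 else 0)"
      by (simp add: link_def split: if_splits)
  qed
  also have "\<dots> = 2 * (\<Sum>j<d. (h $ (nr + j))\<^sup>2) + 2 * (\<Sum>j<d. if Suc j < d then (h $ Suc j)\<^sup>2 else 0)"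
    by (simp add: sum.distrib sum_distrib_left)
  also have "(\<Sum>j<d. if Suc j < d then (h $ Suc j)\<^sup>2 else 0) \<le> (\<Sum>c<nr. (h $ c)\<^sup>2)"
  proof -
    obtain d' where d': "d = Suc d'" using d by (cases d) auto
    have "(\<Sum>j<d. if Suc j < d then (h $ Suc j)\<^sup>2 else 0) = (\<Sum>j<d'. (h $ Suc j)\<^sup>2)"
      unfolding d' by simp
    also have "\<dots> \<le> (\<Sum>c<d. (h $ c)\<^sup>2)" unfolding d' by (subst sum.lessThan_Suc_shift) simp
    also have "\<dots> \<le> (\<Sum>c<nr. (h $ c)\<^sup>2)" using d_le_nr by (intro sum_mono2) auto
    finally show ?thesis .
  qed
  finally show ?thesis
    by (simp add: vnorm_power2[OF h] sum_lessThan_add)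
qed

lemma obj_expansion:
  assumes "x \<in> carrier_vec nc" "y \<in> carrier_vec nc"
  shows "obj y - obj x - obj_grad x \<bullet> (y - x) = L / 4 * (\<Sum>j<d. (link j (y - x))\<^sup>2)"
proof -
  have "(\<Sum>j<d. (link j y)\<^sup>2) = (\<Sum>j<d. (link j x)\<^sup>2 + 2 * (link j x * link j (y - x)) + (link j (y - x))\<^sup>2)"
    using assms by (intro sum.cong) (auto simp: link_diff power2_eq_square algebra_simps)
  moreover have "y - x \<in> carrier_vec nc" "(y - x) $ 0 = y $ 0 - x $ 0" using assms d by auto
  ultimately show ?thesis
    by (simp add: obj_def obj_grad_scalar_prod sum.distrib flip: sum_distrib_left) (simp add: algebra_simps)
qed

lemma has_gradient_obj:
  assumes x: "x \<in> carrier_vec nc"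
  shows "has_gradient nc obj x (obj_grad x)"
proof (rule has_gradient_quadratic[where C = "L / 2"])
  fix y :: "real vec" assume y: "y \<in> carrier_vec nc"
  have yx: "y - x \<in> carrier_vec nc" using x y by simp
  show "\<bar>obj y - obj x - obj_grad x \<bullet> (y - x)\<bar> \<le> L / 2 * (vnorm (y - x))\<^sup>2"
    unfolding obj_expansion[OF x y]
    using mult_left_mono[OF sum_link_power2_le[OF yx], of "L / 4"] L by (simp add: abs_mult sum_nonneg)
qed (use L obj_grad_carrier in auto)

lemma grad_obj: "x \<in> carrier_vec nc \<Longrightarrow> grad nc obj x = obj_grad x"
  using grad_eqI has_gradient_obj by blast

text \<open>The squared norm of the gradient difference \<open>w\<close> is a sum of products of
  links of \<open>u\<close> and \<open>w\<close>. Splitting each product and bounding the links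
  leaves half of \<open>(vnorm w)\<^sup>2\<close> on the right, which is absorbed.\<close>

lemma smooth_fun_obj: "smooth_fun nc L obj"
  unfolding smooth_fun_def
proof (intro conjI ballI)
  fix x y :: "real vec" assume x: "x \<in> carrier_vec nc" and y: "y \<in> carrier_vec nc"
  define w where "w = obj_grad x - obj_grad y"
  define u where "u = x - y"
  have w: "w \<in> carrier_vec nc" and u: "u \<in> carrier_vec nc"
    using x y obj_grad_carrier by (auto simp: w_def u_def)
  have "(vnorm w)\<^sup>2 = obj_grad x \<bullet> w - obj_grad y \<bullet> w"
    unfolding vnorm_power2_scalar_prod
    using minus_scalar_prod_distrib[OF obj_grad_carrier obj_grad_carrier w] by (simp add: w_def)
  also have "\<dots> = L / 2 * (\<Sum>j<d. link j u * link j w)"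
    using x y by (simp add: obj_grad_scalar_prod[OF w] u_def link_diff right_diff_distrib left_diff_distrib
        sum_subtractf)
  also have "\<dots> = (\<Sum>j<d. L / 2 * (link j u * link j w))" by (simp add: sum_distrib_left)
  also have "\<dots> \<le> (\<Sum>j<d. L\<^sup>2 / 4 * (link j u)\<^sup>2 + (link j w)\<^sup>2 / 4)"
  proof (rule sum_mono)
    fix j
    have "0 \<le> (L * link j u - link j w)\<^sup>2" by simp
    then show "L / 2 * (link j u * link j w) \<le> L\<^sup>2 / 4 * (link j u)\<^sup>2 + (link j w)\<^sup>2 / 4"
      by (simp add: power2_eq_square algebra_simps)
  qed
  also have "\<dots> = L\<^sup>2 / 4 * (\<Sum>j<d. (link j u)\<^sup>2) + (\<Sum>j<d. (link j w)\<^sup>2) / 4"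
    by (simp add: sum.distrib sum_distrib_left sum_divide_distrib)
  also have "\<dots> \<le> L\<^sup>2 / 4 * (2 * (vnorm u)\<^sup>2) + (2 * (vnorm w)\<^sup>2) / 4"
    using sum_link_power2_le u w by (intro add_mono mult_left_mono divide_right_mono) auto
  finally have "(vnorm w)\<^sup>2 \<le> (L * vnorm u)\<^sup>2" by (simp add: power_mult_distrib)
  then have "vnorm w \<le> L * vnorm u"
    using L vnorm_nonneg by (intro power2_le_imp_le[of "vnorm w"]) auto
  then show "vnorm (grad nc obj x - grad nc obj y) \<le> L * vnorm (x - y)"
    using x y by (simp add: grad_obj w_def u_def)
qed (use has_gradient_obj in blast)

lemma convex_fun_obj: "convex_fun nc obj"
  unfolding convex_fun_def
proof (intro ballI allI impI)
  fix x y :: "real vec" and t :: real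
  assume x: "x \<in> carrier_vec nc" and y: "y \<in> carrier_vec nc" and t: "0 \<le> t \<and> t \<le> 1"
  have "(\<Sum>j<d. (link j (t \<cdot>\<^sub>v x + (1 - t) \<cdot>\<^sub>v y))\<^sup>2) \<le> (\<Sum>j<d. t * (link j x)\<^sup>2 + (1 - t) * (link j y)\<^sup>2)"
  proof (rule sum_mono)
    fix j assume "j \<in> {..<d}"
    moreover have "(t * p + (1 - t) * q)\<^sup>2 \<le> t * p\<^sup>2 + (1 - t) * q\<^sup>2" for p q
    proof -
      have "0 \<le> t * (1 - t) * (p - q)\<^sup>2" using t by simp
      then show ?thesis by (simp add: power2_eq_square algebra_simps)
    qed
    ultimately show "(link j (t \<cdot>\<^sub>v x + (1 - t) \<cdot>\<^sub>v y))\<^sup>2 \<le> t * (link j x)\<^sup>2 + (1 - t) * (link j y)\<^sup>2"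
      using x y by (simp add: link_convex_comb)
  qed
  also have "\<dots> = t * (\<Sum>j<d. (link j x)\<^sup>2) + (1 - t) * (\<Sum>j<d. (link j y)\<^sup>2)"
    by (simp add: sum.distrib sum_distrib_left)
  finally have "L / 4 * (\<Sum>j<d. (link j (t \<cdot>\<^sub>v x + (1 - t) \<cdot>\<^sub>v y))\<^sup>2)
      \<le> L / 4 * (t * (\<Sum>j<d. (link j x)\<^sup>2) + (1 - t) * (\<Sum>j<d. (link j y)\<^sup>2))"
    using L by (intro mult_left_mono) auto
  moreover have at0: "(t \<cdot>\<^sub>v x + (1 - t) \<cdot>\<^sub>v y) $ 0 = t * x $ 0 + (1 - t) * y $ 0"
    using x y d by auto
  ultimately show "obj (t \<cdot>\<^sub>v x + (1 - t) \<cdot>\<^sub>v y) \<le> t * obj x + (1 - t) * obj y"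
    unfolding obj_def at0 by (simp add: algebra_simps diff_divide_distrib)
qed

section \<open>The solution, its multiplier and the suboptimality\<close>

text \<open>Interior columns have zero gradient and unit coefficients, so the multiplier is constant
  along a run; dividing by \<open>\<delta>\<close> matches the gradient at the run ends.\<close>

definition dual :: "real vec" where
  "dual = vec nr (\<lambda>_. - (L / 2 * s / \<delta>))"

text \<open>Run \<open>c mod d\<close> starts at \<open>s * (d - c mod d)\<close>, so the values
  drop by \<open>s\<close> per run and the last one is \<open>s\<close>.\<close>

definition opt :: "real vec" where
  "opt = vec nc (\<lambda>c. s * real (d - c mod d) * (if d \<le> c \<and> c < nr then \<delta> else 1))"

lemma dual_carrier: "dual \<in> carrier_vec nr" and opt_carrier: "opt \<in> carrier_vec nc"
  by (simp_all add: dual_def opt_def)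

lemma link_opt:
  assumes j: "j < d"
  shows "link j opt = s"
proof (cases "Suc j < d")
  case True
  then show ?thesis using n by (simp add: link_def opt_def of_nat_diff algebra_simps)
next
  case False
  then have "d - j = 1" using j by linarith
  then show ?thesis using False j by (simp add: link_def opt_def)
qed

lemma A_opt: "A *\<^sub>v opt = 0\<^sub>v nr"
proof (rule eq_vecI)
  fix r assume "r < dim_vec (0\<^sub>v nr :: real vec)"
  then have r: "r < nr" by simp
  then have "(A *\<^sub>v opt) $ r = a r * opt $ r - b r * opt $ (r + d)"
    by (intro A_mult opt_carrier)
  also have "\<dots> = 0" using r by (simp add: opt_def a_def b_def)
  finally show "(A *\<^sub>v opt) $ r = 0\<^sub>v nr $ r" using r by simp
qed simp

text \<open>The gradient sees \<open>x\<close> only through its links. Stated for any such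
  \<open>x\<close>, this covers every optimal point and not just \<open>opt\<close>.\<close>

lemma obj_grad_eq_A_dual:
  assumes link: "\<And>j. j < d \<Longrightarrow> link j x = s"
  shows "A\<^sup>T *\<^sub>v dual = obj_grad x"
proof (rule eq_vecI)
  fix c assume "c < dim_vec (obj_grad x)"
  then have c: "c < nc" by (simp add: obj_grad_def)
  have "(A\<^sup>T *\<^sub>v dual) $ c = (if c < nr then a c * dual $ c else 0) - (if d \<le> c then b (c - d) * dual $ (c - d) else 0)"
    by (rule A_transpose_mult[OF dual_carrier c])
  also have "\<dots> = obj_grad x $ c"
  proof -
    consider "c < d" | "d \<le> c" "c < nr" | "nr \<le> c" by linarith
    then show ?thesis
    proof cases
      case 1
      then show ?thesis using \<delta>(1) d_le_nr c link by (auto simp: a_def dual_def obj_grad_def)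
    next
      case 2
      then show ?thesis using c d by (auto simp: a_def b_def dual_def obj_grad_def)
    next
      case 3
      then have "c - d < nr" "d \<le> c" using c d_le_nr by linarith+
      then show ?thesis using 3 \<delta>(1) d c link by (auto simp: b_def dual_def obj_grad_def)
    qed
  qed
  finally show "(A\<^sup>T *\<^sub>v dual) $ c = obj_grad x $ c" .
qed (simp add: obj_grad_def)

lemma grad_scalar_prod_A:
  assumes "y \<in> carrier_vec nr" "x \<in> carrier_vec nc"
  shows "(A\<^sup>T *\<^sub>v y) \<bullet> x = y \<bullet> (A *\<^sub>v x)"
  using transpose_vec_mult_scalar[OF A_carrier assms(2,1)] .

text \<open>Completing the square: the cross term and the linear term of \<open>obj\<close> together
  form the product of \<open>x\<close> with \<open>A\<^sup>T *\<^sub>v dual\<close>, the gradient at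
  \<open>opt\<close>.\<close>

lemma obj_eq_dual:
  assumes x: "x \<in> carrier_vec nc"
  shows "obj x = L / 4 * (\<Sum>j<d. (link j x - s)\<^sup>2) - L / 4 * d * s\<^sup>2 + dual \<bullet> (A *\<^sub>v x)"
proof -
  have "dual \<bullet> (A *\<^sub>v x) = obj_grad opt \<bullet> x"
    using obj_grad_eq_A_dual[of opt] link_opt grad_scalar_prod_A[OF dual_carrier x] by simp
  also have "\<dots> = L / 2 * (s * (\<Sum>j<d. link j x)) - L / 2 * s * x $ 0"
    by (simp add: obj_grad_scalar_prod[OF x] link_opt sum_distrib_left)
  finally have *: "dual \<bullet> (A *\<^sub>v x) = L / 2 * (s * (\<Sum>j<d. link j x)) - L / 2 * s * x $ 0" .
  have "(\<Sum>j<d. (link j x - s)\<^sup>2) = (\<Sum>j<d. (link j x)\<^sup>2 - 2 * s * link j x + s\<^sup>2)"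
    by (simp add: power2_diff algebra_simps)
  also have "\<dots> = (\<Sum>j<d. (link j x)\<^sup>2) - 2 * s * (\<Sum>j<d. link j x) + d * s\<^sup>2"
    by (simp add: sum.distrib sum_subtractf sum_distrib_left)
  finally show ?thesis unfolding * obj_def by (simp only:) (simp add: algebra_simps diff_divide_distrib)
qed

lemma obj_feasible:
  assumes "x \<in> carrier_vec nc" "A *\<^sub>v x = 0\<^sub>v nr"
  shows "obj x = L / 4 * (\<Sum>j<d. (link j x - s)\<^sup>2) - L / 4 * d * s\<^sup>2"
  using obj_eq_dual[OF assms(1)] assms(2) dual_carrier by simp

lemma obj_opt: "obj opt = - (L / 4 * d * s\<^sup>2)"
  using obj_feasible[OF opt_carrier A_opt] by (simp add: link_opt)

lemma obj_opt_le:
  assumes "x \<in> carrier_vec nc" "A *\<^sub>v x = 0\<^sub>v nr"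
  shows "obj opt \<le> obj x"
  using obj_feasible[OF assms] L by (simp add: obj_opt sum_nonneg)

lemma residual_prob: "x \<in> carrier_vec nc \<Longrightarrow> residual prob x = A *\<^sub>v x"
  using A_carrier by (auto simp: residual_def prob_def)

lemma total_obj_prob:
  "x \<in> carrier_vec nc \<Longrightarrow> total_obj prob x = (if A *\<^sub>v x = 0\<^sub>v nr then ereal (obj x) else \<infinity>)"
  by (simp add: total_obj_def residual_prob) (simp add: prob_def set_indicator_def)

lemma prob_dim [simp]: "xdim prob = nc" "cdim prob = nr"
  by (simp_all add: prob_def)

lemma optimal_opt: "optimal prob opt"
  unfolding optimal_def using opt_carrier A_opt obj_opt_le by (simp add: total_obj_prob)

text \<open>A feasible point attaining the value of \<open>opt\<close> leaves no room for a nonzero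
  square.\<close>

lemma optimal_link:
  assumes "optimal prob x" "j < d"
  shows "link j x = s"
proof -
  have x: "x \<in> carrier_vec nc" and fin: "total_obj prob x \<noteq> \<infinity>" and "total_obj prob x \<le> total_obj prob opt"
    using assms opt_carrier by (auto simp: optimal_def)
  then have Ax: "A *\<^sub>v x = 0\<^sub>v nr" and "obj x \<le> obj opt"
    using A_opt opt_carrier by (auto simp: total_obj_prob split: if_splits)
  then have "(\<Sum>j<d. (link j x - s)\<^sup>2) \<le> 0"
    using obj_feasible[OF x Ax] L by (simp add: obj_opt mult_le_0_iff)
  then have "(\<Sum>j<d. (link j x - s)\<^sup>2) = 0" by (intro antisym sum_nonneg) auto
  then show ?thesis using assms(2) by (simp add: sum_nonneg_eq_0_iff)
qed

lemma optimal_dual_dual: "optimal_dual prob opt dual"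
  using dual_carrier grad_obj[OF opt_carrier] obj_grad_eq_A_dual[of opt] link_opt
  by (simp add: optimal_dual_def) (simp add: prob_def)

text \<open>All optimal points have the same links, hence the same gradient.\<close>

lemma optimal_dual_scalar_prod:
  assumes "optimal prob xs" "optimal_dual prob xs ls" "x \<in> carrier_vec nc"
  shows "ls \<bullet> (A *\<^sub>v x) = dual \<bullet> (A *\<^sub>v x)"
proof -
  have ls: "ls \<in> carrier_vec nr" and eq: "A\<^sup>T *\<^sub>v ls = grad nc obj xs"
    using assms(2) by (auto simp: optimal_dual_def prob_def)
  have "xs \<in> carrier_vec nc" using assms(1) by (simp add: optimal_def)
  then have "A\<^sup>T *\<^sub>v ls = A\<^sup>T *\<^sub>v dual"
    using eq obj_grad_eq_A_dual[of xs] optimal_link[OF assms(1)] by (simp add: grad_obj)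
  then show ?thesis
    using grad_scalar_prod_A[OF ls assms(3)] grad_scalar_prod_A[OF dual_carrier assms(3)] by simp
qed

text \<open>Since \<open>\<rho>\<close> dominates the norm of \<open>ls\<close>, the penalty
  outweighs \<open>- (ls \<bullet> (A *\<^sub>v x))\<close>. As \<open>ls\<close> and
  \<open>dual\<close> agree on the range of \<open>A\<close>, only the squares remain.\<close>

lemma SubOpt_prob_ge:
  assumes "optimal prob xs" "optimal_dual prob xs ls" "vnorm ls \<le> \<rho>" and x: "x \<in> carrier_vec nc"
  shows "L / 4 * (\<Sum>j<d. (link j x - s)\<^sup>2) \<le> SubOpt_C prob \<rho> x"
proof -
  have ls: "ls \<in> carrier_vec nr" using assms(2) by (simp add: optimal_dual_def)
  have "Inf (obj ` {y \<in> carrier_vec nc. A *\<^sub>v y = 0\<^sub>v nr}) = obj opt"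
    using opt_carrier A_opt obj_opt_le by (intro cInf_eq_minimum) auto
  then have S: "SubOpt_C prob \<rho> x = obj x - obj opt + \<rho> * vnorm (A *\<^sub>v x)"
    by (simp add: SubOpt_C_def residual_prob[OF x]) (simp add: prob_def)
  have "- (ls \<bullet> (A *\<^sub>v x)) = (- 1 \<cdot>\<^sub>v ls) \<bullet> (A *\<^sub>v x)"
    using ls A_carrier x by simp
  also have "\<dots> \<le> vnorm (- 1 \<cdot>\<^sub>v ls) * vnorm (A *\<^sub>v x)"
    using ls A_carrier x by (intro scalar_prod_le_vnorm[of _ nr]) auto
  also have "\<dots> \<le> \<rho> * vnorm (A *\<^sub>v x)"
    using assms(3) vnorm_nonneg by (auto simp: vnorm_smult intro: mult_right_mono)
  finally show ?thesis
    using optimal_dual_scalar_prod[OF assms(1,2) x] by (simp add: S obj_opt obj_eq_dual[OF x])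
qed

text \<open>All factors \<open>s * (d - c mod d)\<close> are at most \<open>s * d\<close> in size.
  The \<open>n - 1\<close> interior blocks carry weight \<open>1 / n\<close> each and count together
  at most like one block of \<open>d\<close> columns, besides the starts and the ends.\<close>

lemma vnorm_opt: "(vnorm opt)\<^sup>2 \<le> 3 * s\<^sup>2 * real d ^ 3"
proof -
  have "(vnorm opt)\<^sup>2 = (\<Sum>c<nc. (opt $ c)\<^sup>2)" by (rule vnorm_power2[OF opt_carrier])
  also have "\<dots> \<le> (\<Sum>c<nc. s\<^sup>2 * (real d)\<^sup>2 * (if d \<le> c \<and> c < nr then 1 / n else 1))"
    using \<delta>(3) by (intro sum_mono) (auto simp: opt_def power_mult_distrib intro!: mult_left_mono power_mono
        divide_right_mono)
  also have "\<dots> = s\<^sup>2 * (real d)\<^sup>2 * (\<Sum>c<nc. (if d \<le> c \<and> c < nr then 1 / n else 1))"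
    by (simp add: sum_distrib_left)
  also have "\<dots> \<le> s\<^sup>2 * (real d)\<^sup>2 * (3 * d)"
  proof (rule mult_left_mono)
    have eq: "nr = d + (n - 1) * d" using n by (cases n) auto
    have "(\<Sum>c<nc. (if d \<le> c \<and> c < nr then 1 / real n else 1))
        = d + real ((n - 1) * d) * (1 / n) + d"
      unfolding sum_lessThan_add unfolding eq sum_lessThan_add by simp
    also have "real ((n - 1) * d) * (1 / n) \<le> d"
      using n by (simp add: field_simps mult_left_mono)
    finally show "(\<Sum>c<nc. (if d \<le> c \<and> c < nr then 1 / real n else 1)) \<le> 3 * d" by simp
  qed simp
  finally show ?thesis by (simp add: power3_eq_cube power2_eq_square algebra_simps)
qed

lemma prob_in_F_C:
  assumes "1 \<le> \<kappa>" "n = 1 \<or> 3 * real n \<le> \<kappa>" and D: "0 \<le> D" "3 * s\<^sup>2 * real d ^ 3 \<le> D\<^sup>2"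
  shows "prob \<in> F_C L \<kappa> D"
proof -
  have "(vnorm opt)\<^sup>2 \<le> D\<^sup>2" using vnorm_opt D(2) by linarith
  then have "vnorm opt \<le> D" using D(1) by (rule power2_le_imp_le)
  moreover have "0\<^sub>v nc - opt = (- 1) \<cdot>\<^sub>v opt" using opt_carrier by (intro eq_vecI) auto
  ultimately have "vnorm (0\<^sub>v nc - opt) \<le> D" by (simp add: vnorm_smult)
  then have "\<exists>xs. optimal prob xs \<and> vnorm (0\<^sub>v (xdim prob) - xs) \<le> D"
    using optimal_opt by auto
  then show ?thesis
    unfolding F_C_def using n d cond_number_le_A[OF assms(1,2)] convex_fun_obj smooth_fun_obj
      proper_efun_set_indicator_0 closed_efun_set_indicator_0 convex_efun_set_indicator_0
    by (simp add: prob_def)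
qed

lemma eq_constrained_prob: "eq_constrained prob"
  by (simp add: eq_constrained_def prob_def)

section \<open>Propagation of the support\<close>

text \<open>
  The position of a column when the runs are traversed one after the other; each gradient or
  constraint step reaches at most one position further.
\<close>

definition depth :: "nat \<Rightarrow> nat" where
  "depth c = c mod d * (n + 1) + c div d"

definition shallow :: "nat \<Rightarrow> real vec set" where
  "shallow k = {v \<in> carrier_vec nc. \<forall>c<nc. k \<le> depth c \<longrightarrow> v $ c = 0}"

lemma depth_simps:
  assumes "j < d"
  shows "depth j = j * (n + 1)" "depth (n * d + j) = j * (n + 1) + n"
  using assms by (auto simp: depth_def)

lemma depth_add_d: "depth (c + d) = Suc (depth c)"
  using d by (simp add: depth_def)

lemma shallow_mono: "i \<le> k \<Longrightarrow> shallow i \<subseteq> shallow k"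
  unfolding shallow_def by auto

text \<open>The columns of link \<open>j\<close> have consecutive depths, the end of run
  \<open>j\<close> coming first; the link vanishes until that end is reached.\<close>

lemma link_shallow:
  assumes z: "z \<in> shallow k" and j: "j < d" "k \<le> j * (n + 1) + n"
  shows "link j z = 0"
proof -
  have "z $ (nr + j) = 0" using z j by (simp add: shallow_def depth_simps)
  moreover have "z $ Suc j = 0" if "Suc j < d"
    using z j that Suc_less_nc[OF that] by (simp add: shallow_def depth_simps)
  ultimately show ?thesis by (simp add: link_def)
qed

text \<open>A column receives only links whose shallower column is at most one position before it.
  The linear term affects column 0 alone, whose depth is 0.\<close>

lemma obj_grad_shallow:
  assumes z: "z \<in> shallow k"
  shows "obj_grad z \<in> shallow (Suc k)"
  unfolding shallow_def
proof (intro CollectI conjI allI impI)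
  fix c assume c: "c < nc" and k: "Suc k \<le> depth c"
  have "link (c - nr) z = 0" if "nr \<le> c"
    using that c k depth_simps(2)[of "c - nr"] by (intro link_shallow[OF z]) auto
  moreover have "link (c - 1) z = 0" if "0 < c" "c < d"
    using that k by (intro link_shallow[OF z]) (auto simp: depth_simps gr0_conv_Suc)
  moreover have "c \<noteq> 0" using k by (cases "c = 0") (simp_all add: depth_def)
  ultimately show "obj_grad z $ c = 0" using c by (auto simp: obj_grad_def)
qed (rule obj_grad_carrier)

text \<open>Row \<open>r\<close> joins the columns \<open>r\<close> and \<open>r + d\<close> of
  consecutive depths, so a row is active only if its shallower column lies below depth
  \<open>k\<close>; the transpose then reaches one position further.\<close>

lemma A_transpose_A_shallow:
  assumes z: "z \<in> shallow k"
  shows "A\<^sup>T *\<^sub>v (A *\<^sub>v z) \<in> shallow (Suc k)"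
  unfolding shallow_def
proof (intro CollectI conjI allI impI)
  have zc: "z \<in> carrier_vec nc" using z by (simp add: shallow_def)
  then have Az: "A *\<^sub>v z \<in> carrier_vec nr" using A_carrier by simp
  then show "A\<^sup>T *\<^sub>v (A *\<^sub>v z) \<in> carrier_vec nc" using A_carrier by simp
  have 0: "(A *\<^sub>v z) $ r = 0" if "r < nr" "k \<le> depth r" for r
    using that z by (simp add: A_mult[OF zc] shallow_def depth_add_d del: index_mult_mat_vec)
  fix c assume c: "c < nc" and k: "Suc k \<le> depth c"
  have "(A *\<^sub>v z) $ (c - d) = 0" if "d \<le> c"
    using that c k depth_add_d[of "c - d"] by (intro 0) auto
  then show "(A\<^sup>T *\<^sub>v (A *\<^sub>v z)) $ c = 0"
    using c k by (simp add: A_transpose_mult[OF Az] 0 del: index_mult_mat_vec)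
qed

lemma span_set_shallow:
  assumes x0: "x 0 = 0\<^sub>v nc" and x: "\<And>k. x k \<in> span_set prob x k"
  shows "span_set prob x k \<subseteq> shallow k"
proof (induction k rule: less_induct)
  case (less k)
  show ?case
  proof (cases k)
    case 0
    then show ?thesis using x0 by (simp, intro vspan_subset[OF _ shallow_def]) (simp add: shallow_def)
  next
    case (Suc m)
    have IH: "span_set prob x i \<subseteq> shallow i" if "i \<le> m" for i using less Suc that by simp
    have "x i \<in> shallow k" if "i \<le> m" for i
      using IH[OF that] x[of i] shallow_mono[of i k] Suc that by auto
    moreover have "grad nc obj z \<in> shallow k" "A\<^sup>T *\<^sub>v residual prob z \<in> shallow k"
      if "i \<le> m" "z \<in> span_set prob x i" for i z
    proof -
      have z: "z \<in> shallow m" using IH[OF that(1)] that shallow_mono[of i m] by auto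
      then have "z \<in> carrier_vec nc" by (simp add: shallow_def)
      then show "grad nc obj z \<in> shallow k" "A\<^sup>T *\<^sub>v residual prob z \<in> shallow k"
        using obj_grad_shallow[OF z] A_transpose_A_shallow[OF z] Suc by (simp_all add: grad_obj residual_prob)
    qed
    moreover have "smooth_part prob = obj" "cmat prob = A" by (simp_all add: prob_def)
    ultimately show ?thesis unfolding Suc span_set.simps prob_dim
      by (intro vspan_subset[OF _ shallow_def]) (auto simp: Suc)
  qed
qed

text \<open>Run \<open>m\<close> starts at depth \<open>m * (n + 1)\<close>, so the links of the
  last \<open>m\<close> runs vanish and contribute \<open>s\<^sup>2\<close> each.\<close>

lemma SubOpt_shallow_ge:
  assumes "optimal prob xs" "optimal_dual prob xs ls" "vnorm ls \<le> \<rho>"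
    and x: "x \<in> shallow k" and k: "k \<le> m * (n + 1)" and d2: "d = 2 * m"
  shows "L / 4 * m * s\<^sup>2 \<le> SubOpt_C prob \<rho> x"
proof -
  have "real m * s\<^sup>2 = (\<Sum>j<m. (link (m + j) x - s)\<^sup>2)"
  proof -
    have "link (m + j) x = 0" if "j < m" for j
      using that k d2 by (intro link_shallow[OF x]) (auto simp: algebra_simps)
    then show ?thesis by simp
  qed
  also have "\<dots> \<le> (\<Sum>j<d. (link j x - s)\<^sup>2)"
    unfolding d2 mult_2 sum_lessThan_add by (simp add: sum_nonneg)
  finally have "L / 4 * (m * s\<^sup>2) \<le> L / 4 * (\<Sum>j<d. (link j x - s)\<^sup>2)"
    using L by (intro mult_left_mono) auto
  also have "\<dots> \<le> SubOpt_C prob \<rho> x"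
    using SubOpt_prob_ge[OF assms(1-3)] x by (simp add: shallow_def)
  finally show ?thesis by simp
qed

end

section \<open>Choice of the parameters for a given accuracy\<close>

theorem corollary9:
  "\<exists>c0>0. \<exists>c1>0. \<forall>(L::real) (D::real) (\<kappa>::real) (alg :: problem \<Rightarrow> nat \<Rightarrow> real vec) (\<epsilon>::real).
     0 < L \<and> 0 < D \<and> 1 \<le> \<kappa>
     \<and> linear_span_algorithm {P \<in> F_C L \<kappa> D. eq_constrained P} alg
     \<and> 0 < \<epsilon> \<and> \<epsilon> \<le> c0 * L * D\<^sup>2 \<longrightarrow>
     (\<exists>P \<in> F_C L \<kappa> D. eq_constrained P
        \<and> (\<exists>xs ls. optimal P xs \<and> optimal_dual P xs ls)
        \<and> (\<forall>xs ls \<rho> k. optimal P xs \<and> optimal_dual P xs ls \<and> vnorm ls \<le> \<rho>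
             \<and> SubOpt_C P \<rho> (alg P k) \<le> \<epsilon>
             \<longrightarrow> c1 * (\<kappa> * sqrt L * D / sqrt \<epsilon>) \<le> real k))"
proof (rule exI[of _ "1/100"], rule conjI, simp, rule exI[of _ "1/60"], rule conjI, simp,
    intro allI impI, elim conjE)
  fix L D \<kappa> \<epsilon> :: real and alg :: "problem \<Rightarrow> nat \<Rightarrow> real vec"
  assume L: "0 < L" and D: "0 < D" and \<kappa>: "1 \<le> \<kappa>"
    and alg: "linear_span_algorithm {P \<in> F_C L \<kappa> D. eq_constrained P} alg"
    and \<epsilon>: "0 < \<epsilon>" "\<epsilon> \<le> 1 / 100 * L * D\<^sup>2"
  \<comment> \<open>The target bound without \<open>\<kappa>\<close>; the restriction on
    \<open>\<epsilon>\<close> means \<open>r \<ge> 10\<close>, hence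
    \<open>m \<ge> 1\<close>.\<close>
  define r where "r = sqrt L * D / sqrt \<epsilon>"
  define m where "m = nat \<lfloor>r / 10\<rfloor>"
  \<comment> \<open>Rounding down ensures \<open>3 * n \<le> \<kappa>\<close> unless the run has a
    single constraint, where condition number 1 is available.\<close>
  define n where "n = max 1 (nat \<lfloor>\<kappa> / 3\<rfloor>)"
  \<comment> \<open>The largest drop allowed: \<open>3 * s\<^sup>2 * (2 * m) ^ 3\<close> equals
    \<open>D\<^sup>2\<close>.\<close>
  define s where "s = sqrt (D\<^sup>2 / (24 * real m ^ 3))"
  have r2: "r\<^sup>2 = L * D\<^sup>2 / \<epsilon>" using L \<epsilon> by (simp add: r_def power_divide power_mult_distrib)
  have "10\<^sup>2 \<le> r\<^sup>2" unfolding r2 using \<epsilon> by (simp add: le_divide_eq)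
  then have r: "10 \<le> r" using L D \<epsilon> by (intro power2_le_imp_le[of 10]) (auto simp: r_def)
  have "1 \<le> \<lfloor>r / 10\<rfloor>" using r by simp
  then have "r / 20 \<le> real_of_int \<lfloor>r / 10\<rfloor>" by linarith
  moreover have "real_of_int \<lfloor>r / 10\<rfloor> \<le> r / 10" by linarith
  ultimately have m: "m > 0" "real m \<le> r / 10" "r / 20 \<le> real m" using r by (simp_all add: m_def)
  have run: "n > 0" "n = 1 \<or> 3 * real n \<le> \<kappa>" "\<kappa> / 3 \<le> real (n + 1)"
    using \<kappa> by (auto simp: n_def max_def) linarith+
  have s2: "s\<^sup>2 = D\<^sup>2 / (24 * real m ^ 3)" by (simp add: s_def)
  interpret chain n "2 * m" L s
    using L m run by unfold_locales auto
  have "3 * s\<^sup>2 * real (2 * m) ^ 3 \<le> D\<^sup>2" using m by (simp add: s2 power_mult_distrib)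
  then have P: "prob \<in> F_C L \<kappa> D" using D by (intro prob_in_F_C[OF \<kappa> run(2)]) auto
  then have x0: "alg prob 0 = 0\<^sub>v (n * (2 * m) + 2 * m)" and x: "\<And>k. alg prob k \<in> span_set prob (alg prob) k"
    using alg eq_constrained_prob by (auto simp: linear_span_algorithm_def)
  show "\<exists>P\<in>F_C L \<kappa> D. eq_constrained P \<and> (\<exists>xs ls. optimal P xs \<and> optimal_dual P xs ls)
        \<and> (\<forall>xs ls \<rho> k. optimal P xs \<and> optimal_dual P xs ls \<and> vnorm ls \<le> \<rho>
             \<and> SubOpt_C P \<rho> (alg P k) \<le> \<epsilon>
             \<longrightarrow> 1 / 60 * (\<kappa> * sqrt L * D / sqrt \<epsilon>) \<le> real k)"
  proof (rule bexI[OF _ P], intro conjI)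
    show "eq_constrained prob" by (rule eq_constrained_prob)
    show "\<exists>xs ls. optimal prob xs \<and> optimal_dual prob xs ls"
      using optimal_opt optimal_dual_dual by blast
    show "\<forall>xs ls \<rho> k. optimal prob xs \<and> optimal_dual prob xs ls \<and> vnorm ls \<le> \<rho>
             \<and> SubOpt_C prob \<rho> (alg prob k) \<le> \<epsilon>
             \<longrightarrow> 1 / 60 * (\<kappa> * sqrt L * D / sqrt \<epsilon>) \<le> real k"
    proof (intro allI impI, elim conjE)
      fix xs ls \<rho> k
      assume opt: "optimal prob xs" "optimal_dual prob xs ls" "vnorm ls \<le> \<rho>"
        and le: "SubOpt_C prob \<rho> (alg prob k) \<le> \<epsilon>"
      have "\<not> k \<le> m * (n + 1)"
      proof
        assume k: "k \<le> m * (n + 1)"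
        have "alg prob k \<in> shallow k" using span_set_shallow[OF x0 x] x by blast
        then have "L / 4 * m * s\<^sup>2 \<le> \<epsilon>"
          using SubOpt_shallow_ge[OF opt _ k refl] le by (meson order_trans)
        moreover have "L / 4 * m * s\<^sup>2 = L * D\<^sup>2 / (96 * (real m)\<^sup>2)"
          unfolding s2 using m(1) by (simp add: power3_eq_cube power2_eq_square)
        ultimately have "L * D\<^sup>2 \<le> 96 * \<epsilon> * (real m)\<^sup>2"
          using m(1) by (simp add: divide_le_eq algebra_simps)
        \<comment> \<open>The choice \<open>m \<le> r / 10\<close> leaves the factor
          \<open>96 / 100 < 1\<close>, which is the contradiction.\<close>
        also have "\<dots> \<le> 96 * \<epsilon> * (r / 10)\<^sup>2"
          using m \<epsilon> by (intro mult_left_mono power_mono) auto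
        also have "\<dots> = 96 / 100 * (L * D\<^sup>2)" using \<epsilon> r2 by (simp add: power_divide)
        finally show False using L D by simp
      qed
      then have "real m * real (n + 1) \<le> real k" by (metis nle_le of_nat_le_iff of_nat_mult)
      \<comment> \<open>The constant \<open>1 / 60\<close> is \<open>1 / 20\<close>, from rounding
        \<open>r / 10\<close> down, times \<open>1 / 3\<close> from the run length.\<close>
      moreover have "r / 20 * (\<kappa> / 3) \<le> real m * real (n + 1)"
        using m run \<kappa> r by (intro mult_mono) auto
      ultimately show "1 / 60 * (\<kappa> * sqrt L * D / sqrt \<epsilon>) \<le> real k"
        by (simp add: r_def algebra_simps)
    qed
  qed
qed

end
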